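(* Let $0<\alpha<1$, $T>0$, $\phi_0\in\mathbb{R}$, $\Omega=(0,1)$, and let $\varphi=\varphi(t,\theta)$ be the solution, for $0<t\le T$, of the extended parametric differential equation $$\frac{\partial \varphi(t,\theta)}{\partial t}+c_1(\theta)\varphi(t,\theta)=c_0(\theta)F(t,\mathcal{C}[\varphi](t))+c_1(\theta)\phi_0,\quad \theta\in(0,1),\ t>0,\qquad \varphi(0,\theta)=\phi_0,\quad \theta\in(0,1).$$ If $F(t,\phi)\phi\le L|\phi|$ (for all $t\in(0,T]$ and $\phi\in\mathbb{R}$), where $L$ is a positive constant, then there exists a constant $\epsilon>0$ such that $$\|\varphi\|^2_{L^{\infty}(0,T;L^2_{\omega_{\alpha,0}}(\Omega))}+\|\varphi\|^2_{L^{2}(0,T;L^2_{\omega_{\alpha}}(\Omega))}\le C(\epsilon,L,\alpha,\phi_0,T),$$ where $$C(\epsilon,L,\alpha,\phi_0,T)=2\left(\phi_0^{2}\,\alpha\, e^{2\epsilon T}+\left(\frac{L^2}{4\epsilon}\alpha+(L^2+\phi_0^{2})(1-\alpha)\right)e^{2\epsilon T}T\right).$$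
   Context: Notation: for $\theta\in(0,1)$, $$c_0(\theta)=\frac{1}{1-\theta},\quad c_1(\theta)=\frac{\theta}{1-\theta},\quad \omega_\alpha(\theta)=\frac{\theta^{-\alpha}(1-\theta)^{\alpha-1}}{\Gamma(1-\alpha)\Gamma(\alpha)},\quad \omega_{\alpha,0}(\theta)=(1-\theta)\omega_\alpha(\theta),\quad \omega_{\alpha,1}(\theta)=\theta\,\omega_\alpha(\theta),$$ and $\mathcal{C}[\varphi](t)=\int_0^1\varphi(t,\theta)\omega_\alpha(\theta)\,d\theta$. For a weight $\omega$, $\|v\|_{L^2_\omega(\Omega)}^2=\int_0^1 v(\theta)^2\omega(\theta)\,d\theta$, and $L^p(0,T;L^2_\omega(\Omega))$ is the usual Bochner space. Standing assumption: $F(t,\phi)$ is a real-valued function that is continuous, bounded, and Lipschitz continuous with respect to its second variable, so that the problem is well-posed. (The equation arises from the Caputo fractional equation $\frac{d^\alpha\phi}{dt^\alpha}=F(t,\phi(t))$, $\phi(0)=\phi_0$, with $\phi(t)=\mathcal{C}[\varphi](t)$, and its solution satisfies $\varphi(t,\theta)=\phi_0+c_0(\theta)\int_0^t e^{-c_1(\theta)(t-\tau)}F(\tau,\mathcal{C}[\varphi](\tau))\,d\tau$.) *)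

theory Defs
  imports "HOL-Analysis.Analysis" "HOL-Probability.Essential_Supremum"
begin

definition c0 :: "real \<Rightarrow> real"
  where "c0 \<theta> = 1 / (1 - \<theta>)"

definition c1 :: "real \<Rightarrow> real"
  where "c1 \<theta> = \<theta> / (1 - \<theta>)"

definition weight :: "real \<Rightarrow> real \<Rightarrow> real"
  where "weight \<alpha> \<theta> =
    \<theta> powr (- \<alpha>) * (1 - \<theta>) powr (\<alpha> - 1) / (Gamma (1 - \<alpha>) * Gamma \<alpha>)"

definition weight0 :: "real \<Rightarrow> real \<Rightarrow> real"
  where "weight0 \<alpha> \<theta> = (1 - \<theta>) * weight \<alpha> \<theta>"

definition param_mean :: "real \<Rightarrow> (real \<Rightarrow> real \<Rightarrow> real) \<Rightarrow> real \<Rightarrow> real"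
  where "param_mean \<alpha> \<phi> t = (LINT \<theta>:{0<..<1}|lebesgue. \<phi> t \<theta> * weight \<alpha> \<theta>)"

definition admissible_rhs :: "real \<Rightarrow> (real \<Rightarrow> real \<Rightarrow> real) \<Rightarrow> bool"
  where "admissible_rhs T F \<longleftrightarrow>
    continuous_on ({0..T} \<times> UNIV) (\<lambda>(t, x). F t x) \<and>
    (\<exists>M. \<forall>t\<in>{0..T}. \<forall>x. \<bar>F t x\<bar> \<le> M) \<and>
    (\<exists>K. \<forall>t\<in>{0..T}. K-lipschitz_on UNIV (F t))"

(* Classical solution on [0, T]: the differential equation holds pointwise for 0 < t <= T (with a
   one-sided derivative at T) and the initial value is attained continuously. The integrability
   clause says that param_mean is an actual integral and not the default value 0 that the library
   assigns to non-integrable functions. *)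
definition extended_solution ::
  "real \<Rightarrow> real \<Rightarrow> real \<Rightarrow> (real \<Rightarrow> real \<Rightarrow> real) \<Rightarrow> (real \<Rightarrow> real \<Rightarrow> real) \<Rightarrow> bool"
  where "extended_solution \<alpha> T \<phi>0 F \<phi> \<longleftrightarrow>
    (\<forall>t\<in>{0..T}. set_integrable lebesgue {0<..<1} (\<lambda>\<theta>. \<phi> t \<theta> * weight \<alpha> \<theta>)) \<and>
    (\<forall>\<theta>\<in>{0<..<1}.
       \<phi> 0 \<theta> = \<phi>0 \<and>
       continuous_on {0..T} (\<lambda>t. \<phi> t \<theta>) \<and>
       (\<forall>t\<in>{0<..T}. \<exists>D.
          ((\<lambda>s. \<phi> s \<theta>) has_real_derivative D) (at t within {0..T}) \<and>
          D + c1 \<theta> * \<phi> t \<theta> = c0 \<theta> * F t (param_mean \<alpha> \<phi> t) + c1 \<theta> * \<phi>0))"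

(* The space L^2_w(0,1); elements are represented by functions, of which only the values on (0,1)
   up to null sets matter. *)
definition L2w :: "(real \<Rightarrow> real) \<Rightarrow> (real \<Rightarrow> real) set"
  where "L2w w = {v. v \<in> borel_measurable (lebesgue_on {0<..<1}) \<and>
    set_integrable lebesgue {0<..<1} (\<lambda>\<theta>. (v \<theta>)\<^sup>2 * w \<theta>)}"

definition L2w_norm :: "(real \<Rightarrow> real) \<Rightarrow> (real \<Rightarrow> real) \<Rightarrow> real"
  where "L2w_norm w v = sqrt (LINT \<theta>:{0<..<1}|lebesgue. (v \<theta>)\<^sup>2 * w \<theta>)"

(* Strong (Bochner) measurability of u : (0,T) -> L^2_w(0,1): almost everywhere limit, in the
   norm of L^2_w, of simple functions with values in L^2_w. The Banach-valued measurability and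
   integration of the library do not apply, as L^2_w is not a type. *)
definition strongly_measurable_L2w ::
  "real \<Rightarrow> (real \<Rightarrow> real) \<Rightarrow> (real \<Rightarrow> real \<Rightarrow> real) \<Rightarrow> bool"
  where "strongly_measurable_L2w T w u \<longleftrightarrow>
    (AE t in lebesgue_on {0<..<T}. u t \<in> L2w w) \<and>
    (\<exists>s :: nat \<Rightarrow> real \<Rightarrow> real \<Rightarrow> real.
       (\<forall>n. simple_function (lebesgue_on {0<..<T}) (s n)) \<and>
       (\<forall>n. \<forall>t\<in>{0<..<T}. s n t \<in> L2w w) \<and>
       (AE t in lebesgue_on {0<..<T}.
          (\<lambda>n. L2w_norm w (\<lambda>\<theta>. s n t \<theta> - u t \<theta>)) \<longlonglongrightarrow> 0))"

definition bochner_L2 :: "real \<Rightarrow> (real \<Rightarrow> real) \<Rightarrow> (real \<Rightarrow> real \<Rightarrow> real) set"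
  where "bochner_L2 T w = {u. strongly_measurable_L2w T w u \<and>
    set_integrable lebesgue {0<..<T} (\<lambda>t. (L2w_norm w (u t))\<^sup>2)}"

definition bochner_L2_norm :: "real \<Rightarrow> (real \<Rightarrow> real) \<Rightarrow> (real \<Rightarrow> real \<Rightarrow> real) \<Rightarrow> real"
  where "bochner_L2_norm T w u = sqrt (LINT t:{0<..<T}|lebesgue. (L2w_norm w (u t))\<^sup>2)"

definition bochner_Linf :: "real \<Rightarrow> (real \<Rightarrow> real) \<Rightarrow> (real \<Rightarrow> real \<Rightarrow> real) set"
  where "bochner_Linf T w = {u. strongly_measurable_L2w T w u \<and>
    esssup (lebesgue_on {0<..<T}) (\<lambda>t. ereal (L2w_norm w (u t))) < \<infinity>}"

definition bochner_Linf_norm :: "real \<Rightarrow> (real \<Rightarrow> real) \<Rightarrow> (real \<Rightarrow> real \<Rightarrow> real) \<Rightarrow> real"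
  where "bochner_Linf_norm T w u =
    real_of_ereal (esssup (lebesgue_on {0<..<T}) (\<lambda>t. ereal (L2w_norm w (u t))))"

definition energy_const :: "real \<Rightarrow> real \<Rightarrow> real \<Rightarrow> real \<Rightarrow> real \<Rightarrow> real"
  where "energy_const \<epsilon> L \<alpha> \<phi>0 T =
    2 * (\<phi>0\<^sup>2 * \<alpha> * exp (2 * \<epsilon> * T) +
         (L\<^sup>2 / (4 * \<epsilon>) * \<alpha> + (L\<^sup>2 + \<phi>0\<^sup>2) * (1 - \<alpha>)) * exp (2 * \<epsilon> * T) * T)"

end

theory Submission
  imports Defs
begin

text \<open>
  As \<open>\<epsilon>\<close> tends to \<open>0\<close>, the term \<open>L\<^sup>2 \<alpha> T / (2 \<epsilon>)\<close> makes the right-hand side arbitrarily large, so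
  any a priori bound that depends on \<open>\<alpha>\<close>, \<open>T\<close>, \<open>\<phi>\<^sub>0\<close> and \<open>L\<close> alone is enough. Testing the equation
  with \<open>(1 - \<theta>) \<phi> \<omega>\<^sub>\<alpha>\<close> gives, for \<open>E(t) = \<integral> (1 - \<theta>) \<phi>\<^sup>2 \<omega>\<^sub>\<alpha>\<close>, \<open>N(t) = \<integral> \<phi>\<^sup>2 \<omega>\<^sub>\<alpha>\<close> and
  \<open>A = (L + |\<phi>\<^sub>0|)\<^sup>2 \<integral> \<omega>\<^sub>\<alpha>\<close>, the inequality \<open>E' + N \<le> 2 E + A\<close>, and hence
  \<open>E(t) + \<integral>\<^sub>0\<^sup>t N \<le> e\<^bsup>2t\<^esup> (E(0) + A)\<close>. The solution is bounded by \<open>|\<phi>\<^sub>0| + (1 + T) sup |F|\<close> on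
  \<open>[0, T] \<times> (0, 1)\<close>, since \<open>M (1 + t)\<close> with \<open>M = sup |F|\<close> is a supersolution of the equation for
  \<open>\<phi> - \<phi>\<^sub>0\<close> at every \<open>\<theta>\<close>; this justifies all limits under the integral sign. The bound on \<open>F\<close>
  does not enter the estimate.
\<close>

section \<open>Integrals depending on a parameter\<close>

context finite_measure
begin

text \<open>Dominated convergence speaks of sequences, so the limit is tested along sequences in
  \<open>S - {t}\<close>. The constant \<open>B\<close> is an integrable majorant because the
  measure is finite. The conditions leave out \<open>s = t\<close> so that \<open>g s\<close> may be
  a difference quotient.\<close>

lemma tendsto_integral_bounded:
  fixes g :: "real \<Rightarrow> 'a \<Rightarrow> real"
  assumes meas: "\<And>s. s \<in> S - {t} \<Longrightarrow> g s \<in> borel_measurable M"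
    and bound: "\<And>s x. s \<in> S - {t} \<Longrightarrow> x \<in> space M \<Longrightarrow> \<bar>g s x\<bar> \<le> B"
    and lim: "\<And>x. x \<in> space M \<Longrightarrow> ((\<lambda>s. g s x) \<longlongrightarrow> l x) (at t within S)"
  shows "((\<lambda>s. \<integral>x. g s x \<partial>M) \<longlongrightarrow> (\<integral>x. l x \<partial>M)) (at t within S)"
  unfolding tendsto_at_iff_sequentially
proof (intro allI impI)
  fix X :: "nat \<Rightarrow> real"
  assume X: "\<forall>i. X i \<in> S - {t}" "X \<longlonglongrightarrow> t"
  have lim': "(\<lambda>i. g (X i) x) \<longlonglongrightarrow> l x" if "x \<in> space M" for x
    using lim[OF that] X unfolding tendsto_at_iff_sequentially comp_def by blast
  have "(\<lambda>i. \<integral>x. g (X i) x \<partial>M) \<longlonglongrightarrow> (\<integral>x. l x \<partial>M)"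
  proof (rule integral_dominated_convergence[where w = "\<lambda>_. B"])
    show "l \<in> borel_measurable M"
      by (rule borel_measurable_LIMSEQ_real[OF lim']) (use X meas in auto)
  qed (use X meas bound lim' in auto)
  then show "((\<lambda>s. \<integral>x. g s x \<partial>M) \<circ> X) \<longlonglongrightarrow> (\<integral>x. l x \<partial>M)"
    by (simp add: comp_def)
qed

text \<open>By the mean value inequality, the bound \<open>B\<close> on the derivatives also bounds
  the difference quotients, and the preceding lemma passes to the limit in them.\<close>

lemma has_real_derivative_integral_bounded:
  fixes g :: "real \<Rightarrow> 'a \<Rightarrow> real"
  assumes t: "t \<in> {a<..<b}"
    and int: "\<And>s. s \<in> {a<..<b} \<Longrightarrow> integrable M (g s)"
    and der: "\<And>s x. s \<in> {a<..<b} \<Longrightarrow> x \<in> space M \<Longrightarrow>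
                ((\<lambda>s. g s x) has_real_derivative g' s x) (at s)"
    and bound: "\<And>s x. s \<in> {a<..<b} \<Longrightarrow> x \<in> space M \<Longrightarrow> \<bar>g' s x\<bar> \<le> B"
  shows "((\<lambda>s. \<integral>x. g s x \<partial>M) has_real_derivative (\<integral>x. g' t x \<partial>M)) (at t)"
proof -
  have at: "at t within {a<..<b} = at t"
    using t by (intro at_within_open) auto
  have "((\<lambda>s. \<integral>x. (g s x - g t x) / (s - t) \<partial>M) \<longlongrightarrow> (\<integral>x. g' t x \<partial>M)) (at t within {a<..<b})"
  proof (rule tendsto_integral_bounded[where B = B])
    fix s assume s: "s \<in> {a<..<b} - {t}"
    then show "(\<lambda>x. (g s x - g t x) / (s - t)) \<in> borel_measurable M"
      using int[of s] int[of t] t by (auto intro!: borel_measurable_divide borel_measurable_diff)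
    fix x assume x: "x \<in> space M"
    have "norm (g s x - g t x) \<le> B * norm (s - t)"
      by (rule field_differentiable_bound[of "{a<..<b}" _ "\<lambda>s. g' s x"])
         (use der bound x s t in \<open>auto intro: has_field_derivative_at_within\<close>)
    then show "\<bar>(g s x - g t x) / (s - t)\<bar> \<le> B"
      using s by (simp add: divide_le_eq)
  next
    fix x assume "x \<in> space M"
    then show "((\<lambda>s. (g s x - g t x) / (s - t)) \<longlongrightarrow> g' t x) (at t within {a<..<b})"
      using der[OF t] by (simp add: at has_field_derivative_iff)
  qed
  then have "((\<lambda>s. ((\<integral>x. g s x \<partial>M) - (\<integral>x. g t x \<partial>M)) / (s - t)) \<longlongrightarrow> (\<integral>x. g' t x \<partial>M))
      (at t within {a<..<b})"
  proof (rule Lim_transform_eventually)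
    show "\<forall>\<^sub>F s in at t within {a<..<b}. (\<integral>x. (g s x - g t x) / (s - t) \<partial>M) =
        ((\<integral>x. g s x \<partial>M) - (\<integral>x. g t x \<partial>M)) / (s - t)"
      using int t by (auto simp: eventually_at_topological intro!: exI[of _ UNIV])
  qed
  then show ?thesis
    by (simp add: at has_field_derivative_iff)
qed

end

section \<open>The weighted measure\<close>

abbreviation unit_lebesgue :: "real measure"
  where "unit_lebesgue \<equiv> lebesgue_on {0<..<1}"

text \<open>The density is that of the Beta distribution with parameters \<open>1 - \<alpha>\<close>
  and \<open>\<alpha>\<close>. Absorbing the weight into the measure turns weighted integrals into
  plain ones over a finite measure.\<close>

definition weight_measure :: "real \<Rightarrow> real measure"
  where "weight_measure \<alpha> = density unit_lebesgue (\<lambda>\<theta>. ennreal (weight \<alpha> \<theta>))"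

lemma space_weight_measure [simp]: "space (weight_measure \<alpha>) = {0<..<1}"
  by (simp add: weight_measure_def)

lemma sets_weight_measure [measurable_cong, simp]:
  "sets (weight_measure \<alpha>) = sets unit_lebesgue"
  by (simp add: weight_measure_def)

lemma borel_measurable_unit_lebesgue [measurable_dest]:
  "f \<in> borel_measurable borel \<Longrightarrow> f \<in> borel_measurable unit_lebesgue"
  by (simp add: measurable_completion measurable_restrict_space1)

lemma weight_measurable [measurable]: "weight \<alpha> \<in> borel_measurable unit_lebesgue"
  by (rule borel_measurable_unit_lebesgue) (unfold weight_def[abs_def], measurable)

lemma weight_pos:
  assumes "0 < \<alpha>" "\<alpha> < 1" "\<theta> \<in> {0<..<1}"
  shows "0 < weight \<alpha> \<theta>"
  using assms by (auto simp: weight_def intro!: divide_pos_pos mult_pos_pos Gamma_real_pos)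

lemma integral_weight:
  assumes "0 < \<alpha>" "\<alpha> < 1" "v \<in> borel_measurable unit_lebesgue"
  shows "(LINT \<theta>:{0<..<1}|lebesgue. v \<theta> * weight \<alpha> \<theta>) = (\<integral>\<theta>. v \<theta> \<partial>weight_measure \<alpha>)"
proof -
  have "(\<integral>\<theta>. v \<theta> \<partial>weight_measure \<alpha>) = (\<integral>\<theta>. weight \<alpha> \<theta> * v \<theta> \<partial>unit_lebesgue)"
    unfolding weight_measure_def using assms weight_pos
    by (subst integral_density) (auto intro!: AE_I2 less_imp_le)
  then show ?thesis
    by (simp add: set_lebesgue_integral_def integral_restrict_space mult.commute)
qed

lemma set_integrable_weight_iff:
  assumes "0 < \<alpha>" "\<alpha> < 1" "v \<in> borel_measurable unit_lebesgue"
  shows "set_integrable lebesgue {0<..<1} (\<lambda>\<theta>. v \<theta> * weight \<alpha> \<theta>) \<longleftrightarrow>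
    integrable (weight_measure \<alpha>) v"
proof -
  have "integrable (weight_measure \<alpha>) v \<longleftrightarrow> integrable unit_lebesgue (\<lambda>\<theta>. weight \<alpha> \<theta> * v \<theta>)"
    unfolding weight_measure_def using assms weight_pos
    by (subst integrable_density) (auto intro!: AE_I2 less_imp_le)
  then show ?thesis
    by (simp add: set_integrable_def integrable_restrict_space mult.commute)
qed

text \<open>Up to the constant factor this is Euler's Beta integral, which converges because both
  parameters \<open>1 - \<alpha>\<close> and \<open>\<alpha>\<close> are positive. The exponent is
  kept as \<open>1 - \<alpha> - 1\<close> to match its usual form.\<close>

lemma set_integrable_weight:
  assumes "0 < \<alpha>" "\<alpha> < 1"
  shows "set_integrable lebesgue {0<..<1} (weight \<alpha>)"
proof -
  have "(\<lambda>t. t powr (1 - \<alpha> - 1) * (1 - t) powr (\<alpha> - 1)) absolutely_integrable_on {0..1}"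
    using assms by (intro nonnegative_absolutely_integrable_1 integrable_Beta') auto
  then have "(\<lambda>t. t powr (1 - \<alpha> - 1) * (1 - t) powr (\<alpha> - 1)) absolutely_integrable_on {0<..<1}"
    by (simp only: absolutely_integrable_on_Icc_iff_Ioo)
  then have "set_integrable lebesgue {0<..<1}
      (\<lambda>t. t powr (1 - \<alpha> - 1) * (1 - t) powr (\<alpha> - 1) / (Gamma (1 - \<alpha>) * Gamma \<alpha>))"
    by (rule set_integrable_divide)
  then show ?thesis
    by (simp add: weight_def[abs_def])
qed

lemma finite_measure_weight_measure:
  assumes "0 < \<alpha>" "\<alpha> < 1"
  shows "finite_measure (weight_measure \<alpha>)"
proof -
  have "integrable (weight_measure \<alpha>) (\<lambda>_. 1 :: real)"
    using set_integrable_weight_iff[OF assms, of "\<lambda>_. 1"] set_integrable_weight[OF assms] by simp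
  then show ?thesis
    by (intro finite_measureI) (simp add: integrable_iff_bounded)
qed

section \<open>Approximation of the identity by simple functions\<close>

text \<open>Rounding down to a multiple of \<open>1 / (n + 1)\<close>. Rounding down keeps the value
  in \<open>{0..T}\<close>, where the solution is controlled, and on a bounded interval only
  finitely many values occur.\<close>

definition grid :: "nat \<Rightarrow> real \<Rightarrow> real"
  where "grid n t = real_of_int \<lfloor>real (Suc n) * t\<rfloor> / real (Suc n)"

lemma grid_bounds:
  assumes "t \<ge> 0"
  shows "0 \<le> grid n t" "grid n t \<le> t" "t - 1 / real (Suc n) \<le> grid n t"
proof -
  show "0 \<le> grid n t"
    using assms by (simp add: grid_def)
  have "real_of_int \<lfloor>real (Suc n) * t\<rfloor> \<le> real (Suc n) * t"
    by linarith
  then show "grid n t \<le> t"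
    unfolding grid_def by (simp add: divide_le_eq mult.commute del: of_nat_Suc)
  have "real (Suc n) * t - 1 \<le> real_of_int \<lfloor>real (Suc n) * t\<rfloor>"
    by linarith
  then have "(real (Suc n) * t - 1) / real (Suc n) \<le> grid n t"
    unfolding grid_def by (intro divide_right_mono) auto
  then show "t - 1 / real (Suc n) \<le> grid n t"
    by (simp add: diff_divide_distrib del: of_nat_Suc)
qed

lemma grid_mem: "t \<in> {0..T} \<Longrightarrow> grid n t \<in> {0..T}"
  using grid_bounds[of t n] by auto

lemma grid_tendsto:
  assumes "t \<ge> 0"
  shows "(\<lambda>n. grid n t) \<longlonglongrightarrow> t"
proof (rule tendsto_sandwich)
  show "(\<lambda>n. t - 1 / real (Suc n)) \<longlonglongrightarrow> t"
    using tendsto_diff[OF tendsto_const[of t] LIMSEQ_inverse_real_of_nat] by (simp add: inverse_eq_divide)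
qed (use grid_bounds[OF assms] in auto)

lemma simple_function_grid: "simple_function (lebesgue_on {0<..<T}) (grid n)"
proof (rule simple_function_borel_measurable)
  have "grid n \<in> borel_measurable borel"
    unfolding grid_def[abs_def] by measurable
  then show "grid n \<in> borel_measurable (lebesgue_on {0<..<T})"
    by (simp add: measurable_completion measurable_restrict_space1)
  have "grid n ` {0<..<T} \<subseteq> (\<lambda>k. real_of_int k / real (Suc n)) ` {0..\<lfloor>real (Suc n) * T\<rfloor>}"
  proof
    fix y assume "y \<in> grid n ` {0<..<T}"
    then obtain t where t: "0 < t" "t < T" "y = grid n t"
      by auto
    then have "\<lfloor>real (Suc n) * t\<rfloor> \<in> {0..\<lfloor>real (Suc n) * T\<rfloor>}"
      by (auto intro!: floor_mono mult_left_mono)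
    then show "y \<in> (\<lambda>k. real_of_int k / real (Suc n)) ` {0..\<lfloor>real (Suc n) * T\<rfloor>}"
      unfolding t grid_def by blast
  qed
  then show "finite (grid n ` space (lebesgue_on {0<..<T}))"
    by (simp add: finite_subset)
qed

section \<open>A priori estimate for the extended equation\<close>

locale extended_problem =
  fixes \<alpha> T \<phi>0 L :: real and F \<phi> :: "real \<Rightarrow> real \<Rightarrow> real"
  assumes \<alpha>: "0 < \<alpha>" "\<alpha> < 1" and T: "T > 0" and L: "L > 0"
    and admissible: "admissible_rhs T F"
    and growth: "\<And>t x. t \<in> {0<..T} \<Longrightarrow> F t x * x \<le> L * \<bar>x\<bar>"
    and solution: "extended_solution \<alpha> T \<phi>0 F \<phi>"
begin

abbreviation \<mu> :: "real measure"
  where "\<mu> \<equiv> weight_measure \<alpha>"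

sublocale finite_measure \<mu>
  using \<alpha> by (rule finite_measure_weight_measure)

definition f :: "real \<Rightarrow> real"
  where "f t = F t (param_mean \<alpha> \<phi> t)"

text \<open>The time derivative of the solution multiplied by \<open>1 - \<theta>\<close>. Unlike
  \<open>c0\<close> and \<open>c1\<close>, it stays bounded as \<theta> tends to 1.\<close>

definition flux :: "real \<Rightarrow> real \<Rightarrow> real"
  where "flux t \<theta> = f t + \<theta> * \<phi>0 - \<theta> * \<phi> t \<theta>"

definition energy :: "real \<Rightarrow> real"
  where "energy t = (\<integral>\<theta>. (1 - \<theta>) * (\<phi> t \<theta>)\<^sup>2 \<partial>\<mu>)"

definition sqnorm :: "real \<Rightarrow> real"
  where "sqnorm t = (\<integral>\<theta>. (\<phi> t \<theta>)\<^sup>2 \<partial>\<mu>)"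

definition M :: real
  where "M = (SOME M. M \<ge> 0 \<and> (\<forall>t\<in>{0..T}. \<forall>x. \<bar>F t x\<bar> \<le> M))"

definition B :: real
  where "B = \<bar>\<phi>0\<bar> + M * (1 + T)"

lemma M: "M \<ge> 0" "t \<in> {0..T} \<Longrightarrow> \<bar>F t x\<bar> \<le> M"
proof -
  obtain K where "\<forall>t\<in>{0..T}. \<forall>x. \<bar>F t x\<bar> \<le> K"
    using admissible by (auto simp: admissible_rhs_def)
  then have "max K 0 \<ge> 0 \<and> (\<forall>t\<in>{0..T}. \<forall>x. \<bar>F t x\<bar> \<le> max K 0)"
    by (auto simp: le_max_iff_disj)
  then have "M \<ge> 0 \<and> (\<forall>t\<in>{0..T}. \<forall>x. \<bar>F t x\<bar> \<le> M)"
    unfolding M_def by (rule someI)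
  then show "M \<ge> 0" "t \<in> {0..T} \<Longrightarrow> \<bar>F t x\<bar> \<le> M"
    by blast+
qed

lemma f_bound: "t \<in> {0..T} \<Longrightarrow> \<bar>f t\<bar> \<le> M"
  by (simp add: f_def M)

lemma B_nonneg: "B \<ge> 0"
  using M T by (simp add: B_def)

section \<open>Pointwise bounds on the solution\<close>

lemma initial: "\<theta> \<in> {0<..<1} \<Longrightarrow> \<phi> 0 \<theta> = \<phi>0"
  and continuous_in_time: "\<theta> \<in> {0<..<1} \<Longrightarrow> continuous_on {0..T} (\<lambda>t. \<phi> t \<theta>)"
  using solution by (auto simp: extended_solution_def)

lemma derivative:
  assumes "\<theta> \<in> {0<..<1}" "t \<in> {0<..<T}"
  shows "((\<lambda>s. \<phi> s \<theta>) has_real_derivative flux t \<theta> / (1 - \<theta>)) (at t)"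
proof -
  obtain D where D: "((\<lambda>s. \<phi> s \<theta>) has_real_derivative D) (at t within {0..T})"
    "D + c1 \<theta> * \<phi> t \<theta> = c0 \<theta> * f t + c1 \<theta> * \<phi>0"
    using solution assms by (force simp: extended_solution_def f_def)
  have "D = (f t + \<theta> * \<phi>0) / (1 - \<theta>) - \<theta> / (1 - \<theta>) * \<phi> t \<theta>"
    using D(2) by (simp add: c0_def c1_def add_divide_distrib)
  also have "\<dots> = flux t \<theta> / (1 - \<theta>)"
    by (simp add: flux_def diff_divide_distrib)
  finally have "D = flux t \<theta> / (1 - \<theta>)" .
  then show ?thesis
    using D(1) assms at_within_Icc_at[of 0 t T] by simp
qed

text \<open>Measurability in \<theta> is recovered from the integrability of the weighted solution:
  the weight is positive on the unit interval and can be divided out.\<close>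

lemma solution_measurable [measurable]:
  assumes "t \<in> {0..T}"
  shows "\<phi> t \<in> borel_measurable unit_lebesgue"
proof -
  have "integrable unit_lebesgue (\<lambda>\<theta>. \<phi> t \<theta> * weight \<alpha> \<theta>)"
    using solution assms
    by (simp add: extended_solution_def set_integrable_def integrable_restrict_space)
  then have "(\<lambda>\<theta>. \<phi> t \<theta> * weight \<alpha> \<theta> / weight \<alpha> \<theta>) \<in> borel_measurable unit_lebesgue"
    by (intro borel_measurable_divide weight_measurable) auto
  then show ?thesis
    by (rule measurable_cong[THEN iffD1, rotated]) (use weight_pos \<alpha> in force)
qed

lemma solution_measurable_\<mu> [measurable]: "t \<in> {0..T} \<Longrightarrow> \<phi> t \<in> borel_measurable \<mu>"
  using solution_measurable by (simp cong: measurable_cong_sets)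

lemma ident_measurable_\<mu> [measurable]: "(\<lambda>\<theta>. \<theta>) \<in> borel_measurable \<mu>"
  using borel_measurable_unit_lebesgue[of "\<lambda>\<theta>. \<theta>"] by (simp cong: measurable_cong_sets)

text \<open>Comparison with the supersolution \<open>M * (1 + t)\<close>, for both signs
  \<open>\<sigma>\<close> at once. The gap to it, multiplied by the integrating factor
  \<open>exp (c * s)\<close>, is nondecreasing in time and starts at \<open>M\<close>. The bound is
  uniform in \<theta> although \<open>c\<close> is unbounded near 1.\<close>

lemma increment_bound:
  assumes \<theta>: "\<theta> \<in> {0<..<1}" and t: "t \<in> {0..T}" and \<sigma>: "\<bar>\<sigma>\<bar> = 1"
  shows "\<sigma> * (\<phi> t \<theta> - \<phi>0) \<le> M * (1 + t)"
proof -
  define c where "c = \<theta> / (1 - \<theta>)"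
  define z where "z s = exp (c * s) * (M * (1 + s) - \<sigma> * (\<phi> s \<theta> - \<phi>0))" for s
  have "z 0 \<le> z t"
  proof (rule DERIV_nonneg_imp_increasing_open[where f = z])
    fix s assume s: "0 < s" "s < t"
    have "M \<ge> \<sigma> * f s"
      using f_bound[of s] s t \<sigma> by (auto simp: abs_if split: if_splits)
    moreover have "M * s * \<theta> \<ge> 0"
      using M s \<theta> by simp
    \<comment> \<open>After multiplication by \<open>1 - \<theta>\<close> the terms with
      \<open>\<phi> s \<theta>\<close> and \<open>\<phi>0\<close> cancel, and two nonnegative parts
      remain: \<open>M - \<sigma> * f s\<close> and \<open>M * s * \<theta>\<close>.\<close>
    moreover have "(1 - \<theta>) * (M - \<sigma> * (flux s \<theta> / (1 - \<theta>)) + c * (M * (1 + s) - \<sigma> * (\<phi> s \<theta> - \<phi>0)))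
        = M - \<sigma> * f s + M * s * \<theta>"
    proof -
      have mult: "(1 - \<theta>) * (M - \<sigma> * w + c * y) = (1 - \<theta>) * M - \<sigma> * ((1 - \<theta>) * w) + ((1 - \<theta>) * c) * y" for w y
        by (simp add: algebra_simps)
      have "(1 - \<theta>) * c = \<theta>" "(1 - \<theta>) * (flux s \<theta> / (1 - \<theta>)) = flux s \<theta>"
        using \<theta> by (simp_all add: c_def)
      then show ?thesis
        unfolding mult by (simp only: flux_def) (simp add: algebra_simps)
    qed
    ultimately have "(1 - \<theta>) * (M - \<sigma> * (flux s \<theta> / (1 - \<theta>)) + c * (M * (1 + s) - \<sigma> * (\<phi> s \<theta> - \<phi>0))) \<ge> 0"
      by linarith
    then have "M - \<sigma> * (flux s \<theta> / (1 - \<theta>)) + c * (M * (1 + s) - \<sigma> * (\<phi> s \<theta> - \<phi>0)) \<ge> 0"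
      using \<theta> by (simp add: zero_le_mult_iff)
    moreover have "(z has_real_derivative exp (c * s) *
        (M - \<sigma> * (flux s \<theta> / (1 - \<theta>)) + c * (M * (1 + s) - \<sigma> * (\<phi> s \<theta> - \<phi>0)))) (at s)"
      unfolding z_def using s t
      by (auto intro!: derivative_eq_intros derivative[OF \<theta>] simp: algebra_simps)
    ultimately show "\<exists>y. DERIV z s :> y \<and> y \<ge> 0"
      by (meson exp_ge_zero mult_nonneg_nonneg)
  next
    show "continuous_on {0..t} z"
      unfolding z_def using t
      by (intro continuous_intros continuous_on_subset[OF continuous_in_time[OF \<theta>]]) auto
  qed (use t in auto)
  then have "0 \<le> z t"
    using M initial[OF \<theta>] by (simp add: z_def)
  then show ?thesis
    by (simp add: z_def zero_le_mult_iff)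
qed

lemma solution_bound:
  assumes "\<theta> \<in> {0<..<1}" "t \<in> {0..T}"
  shows "\<bar>\<phi> t \<theta>\<bar> \<le> B"
proof -
  have "\<bar>\<phi> t \<theta> - \<phi>0\<bar> \<le> M * (1 + t)"
    using increment_bound[OF assms, of 1] increment_bound[OF assms, of "-1"] by (simp add: abs_if)
  also have "\<dots> \<le> M * (1 + T)"
    using M assms by (intro mult_left_mono) auto
  finally show ?thesis
    by (simp add: B_def)
qed

lemma flux_bound:
  assumes "\<theta> \<in> {0<..<1}" "t \<in> {0..T}"
  shows "\<bar>flux t \<theta>\<bar> \<le> M + \<bar>\<phi>0\<bar> + B"
proof -
  have "\<bar>\<theta> * \<phi>0\<bar> \<le> \<bar>\<phi>0\<bar>" "\<bar>\<theta> * \<phi> t \<theta>\<bar> \<le> \<bar>\<phi> t \<theta>\<bar>"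
    using assms by (auto simp: abs_mult mult_left_le_one_le)
  then show ?thesis
    unfolding flux_def using f_bound[OF assms(2)] solution_bound[OF assms] by linarith
qed

lemma solution_sq_bound:
  assumes "\<theta> \<in> {0<..<1}" "t \<in> {0..T}"
  shows "(\<phi> t \<theta>)\<^sup>2 \<le> B\<^sup>2"
  using power_mono[OF solution_bound[OF assms], of 2] by simp

section \<open>Integrability in \<theta> and continuity in time\<close>

lemma bounded_integrable:
  fixes v :: "real \<Rightarrow> real"
  assumes "v \<in> borel_measurable \<mu>" "\<And>\<theta>. \<theta> \<in> {0<..<1} \<Longrightarrow> \<bar>v \<theta>\<bar> \<le> K"
  shows "integrable \<mu> v"
  using assms by (intro integrable_const_bound[where B = K]) auto

lemma solution_integrable: "t \<in> {0..T} \<Longrightarrow> integrable \<mu> (\<phi> t)"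
  by (rule bounded_integrable[OF _ solution_bound]) auto

lemma solution_sq_integrable: "t \<in> {0..T} \<Longrightarrow> integrable \<mu> (\<lambda>\<theta>. (\<phi> t \<theta>)\<^sup>2)"
  by (rule bounded_integrable[where K = "B\<^sup>2"]) (auto intro: solution_sq_bound)

lemma theta_mult_integrable:
  assumes "integrable \<mu> v"
  shows "integrable \<mu> (\<lambda>\<theta>. \<theta> * v \<theta>)"
  using assms
  by (rule Bochner_Integration.integrable_bound)
     (use assms in \<open>auto intro!: AE_I2 simp: abs_mult mult_left_le_one_le\<close>)

lemma energy_integrable:
  assumes "t \<in> {0..T}"
  shows "integrable \<mu> (\<lambda>\<theta>. (1 - \<theta>) * (\<phi> t \<theta>)\<^sup>2)"
  using theta_mult_integrable[OF solution_sq_integrable[OF assms]] solution_sq_integrable[OF assms]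
  by (simp add: left_diff_distrib)

lemma continuous_energy: "continuous_on {0..T} energy"
  unfolding continuous_on_def energy_def
proof
  fix t assume t: "t \<in> {0..T}"
  show "((\<lambda>t. \<integral>\<theta>. (1 - \<theta>) * (\<phi> t \<theta>)\<^sup>2 \<partial>\<mu>) \<longlongrightarrow> (\<integral>\<theta>. (1 - \<theta>) * (\<phi> t \<theta>)\<^sup>2 \<partial>\<mu>)) (at t within {0..T})"
  proof (rule tendsto_integral_bounded[where B = "B\<^sup>2"])
    fix s \<theta> assume s: "s \<in> {0..T} - {t}" and \<theta>: "\<theta> \<in> space \<mu>"
    have "\<bar>(1 - \<theta>) * (\<phi> s \<theta>)\<^sup>2\<bar> \<le> (\<phi> s \<theta>)\<^sup>2"
      using \<theta> by (simp add: abs_mult mult_left_le_one_le)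
    also have "\<dots> \<le> B\<^sup>2"
      using s \<theta> by (intro solution_sq_bound) auto
    finally show "\<bar>(1 - \<theta>) * (\<phi> s \<theta>)\<^sup>2\<bar> \<le> B\<^sup>2" .
  next
    fix \<theta> assume "\<theta> \<in> space \<mu>"
    then show "((\<lambda>s. (1 - \<theta>) * (\<phi> s \<theta>)\<^sup>2) \<longlongrightarrow> (1 - \<theta>) * (\<phi> t \<theta>)\<^sup>2) (at t within {0..T})"
      using continuous_in_time t by (auto simp: continuous_on_def intro!: tendsto_intros)
  qed auto
qed

lemma continuous_sqnorm: "continuous_on {0..T} sqnorm"
  unfolding continuous_on_def sqnorm_def
proof
  fix t assume t: "t \<in> {0..T}"
  show "((\<lambda>t. \<integral>\<theta>. (\<phi> t \<theta>)\<^sup>2 \<partial>\<mu>) \<longlongrightarrow> (\<integral>\<theta>. (\<phi> t \<theta>)\<^sup>2 \<partial>\<mu>)) (at t within {0..T})"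
  proof (rule tendsto_integral_bounded[where B = "B\<^sup>2"])
    fix \<theta> assume "\<theta> \<in> space \<mu>"
    then show "((\<lambda>s. (\<phi> s \<theta>)\<^sup>2) \<longlongrightarrow> (\<phi> t \<theta>)\<^sup>2) (at t within {0..T})"
      using continuous_in_time t by (auto simp: continuous_on_def intro!: tendsto_intros)
  qed (auto intro: solution_sq_bound)
qed

section \<open>Energy inequality and Gronwall argument\<close>

lemma sqnorm_nonneg: "sqnorm t \<ge> 0"
  by (simp add: sqnorm_def)

lemma energy_nonneg: "energy t \<ge> 0"
  unfolding energy_def by (rule integral_nonneg_AE) (auto intro!: AE_I2)

lemma param_mean_eq: "t \<in> {0..T} \<Longrightarrow> param_mean \<alpha> \<phi> t = (\<integral>\<theta>. \<phi> t \<theta> \<partial>\<mu>)"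
  unfolding param_mean_def by (rule integral_weight[OF \<alpha>]) simp

text \<open>The factor \<open>1 - \<theta>\<close> in the energy cancels the denominator in the time
  derivative of the solution. The differentiated integrand is therefore bounded uniformly in
  \<theta>, and differentiation under the integral sign is legitimate.\<close>

lemma energy_derivative:
  assumes "t \<in> {0<..<T}"
  shows "(energy has_real_derivative (\<integral>\<theta>. 2 * \<phi> t \<theta> * flux t \<theta> \<partial>\<mu>)) (at t)"
  unfolding energy_def[abs_def]
proof (rule has_real_derivative_integral_bounded[OF assms, where B = "2 * B * (M + \<bar>\<phi>0\<bar> + B)"])
  fix s \<theta> assume s: "s \<in> {0<..<T}" and \<theta>: "\<theta> \<in> space \<mu>"
  show "((\<lambda>s. (1 - \<theta>) * (\<phi> s \<theta>)\<^sup>2) has_real_derivative 2 * \<phi> s \<theta> * flux s \<theta>) (at s)"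
    using \<theta> by (auto intro!: derivative_eq_intros derivative s)
  show "\<bar>2 * \<phi> s \<theta> * flux s \<theta>\<bar> \<le> 2 * B * (M + \<bar>\<phi>0\<bar> + B)"
    unfolding abs_mult
    by (intro mult_mono) (use s \<theta> solution_bound[of \<theta> s] flux_bound[of \<theta> s] B_nonneg in auto)
qed (auto intro: energy_integrable)

text \<open>Since \<open>f t\<close> does not depend on \<theta>, its contribution integrates to
  \<open>2 * f t * m\<close> with \<open>m\<close> the mean of the solution, which is exactly where
  the growth condition applies. The damping term
  \<open>- 2 * \<theta> * (\<phi> t \<theta>)\<^sup>2\<close> is split into twice the energy density
  minus twice the square; one of these squares absorbs the linear terms and the other gives
  \<open>sqnorm t\<close>.\<close>

lemma energy_inequality:
  assumes t: "t \<in> {0<..<T}"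
  shows "(\<integral>\<theta>. 2 * \<phi> t \<theta> * flux t \<theta> \<partial>\<mu>) + sqnorm t
    \<le> 2 * energy t + (L + \<bar>\<phi>0\<bar>)\<^sup>2 * measure \<mu> (space \<mu>)"
proof -
  have t': "t \<in> {0..T}"
    using t by simp
  note int = solution_integrable[OF t'] solution_sq_integrable[OF t'] energy_integrable[OF t']
  note int' = theta_mult_integrable[OF int(1)] theta_mult_integrable[OF int(2)]
  define m where "m = param_mean \<alpha> \<phi> t"
  have "\<bar>m\<bar> \<le> (\<integral>\<theta>. \<bar>\<phi> t \<theta>\<bar> \<partial>\<mu>)"
    unfolding m_def param_mean_eq[OF t'] by (rule integral_abs_bound)
  \<comment> \<open>The growth condition is taken at the argument \<open>m\<close>, the same mean at
    which \<open>F\<close> is evaluated in the equation.\<close>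
  moreover have "f t * m \<le> L * \<bar>m\<bar>"
    unfolding f_def m_def using growth t by simp
  ultimately have fm: "f t * m \<le> L * (\<integral>\<theta>. \<bar>\<phi> t \<theta>\<bar> \<partial>\<mu>)"
    using L by (meson mult_left_mono order.trans less_imp_le)
  have "(\<integral>\<theta>. 2 * \<phi> t \<theta> * flux t \<theta> \<partial>\<mu>) =
      (\<integral>\<theta>. 2 * f t * \<phi> t \<theta> + 2 * \<phi>0 * (\<theta> * \<phi> t \<theta>) - 2 * (\<theta> * (\<phi> t \<theta>)\<^sup>2) \<partial>\<mu>)"
    by (simp add: flux_def algebra_simps power2_eq_square)
  also have "\<dots> = 2 * (f t * m) + (\<integral>\<theta>. 2 * \<phi>0 * (\<theta> * \<phi> t \<theta>) - 2 * (\<theta> * (\<phi> t \<theta>)\<^sup>2) \<partial>\<mu>)"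
    unfolding m_def param_mean_eq[OF t'] using int int' by simp
  also have "\<dots> \<le> 2 * (L * (\<integral>\<theta>. \<bar>\<phi> t \<theta>\<bar> \<partial>\<mu>)) + (\<integral>\<theta>. 2 * \<phi>0 * (\<theta> * \<phi> t \<theta>) - 2 * (\<theta> * (\<phi> t \<theta>)\<^sup>2) \<partial>\<mu>)"
    using fm by simp
  also have "\<dots> = (\<integral>\<theta>. 2 * L * \<bar>\<phi> t \<theta>\<bar> + (2 * \<phi>0 * (\<theta> * \<phi> t \<theta>) - 2 * (\<theta> * (\<phi> t \<theta>)\<^sup>2)) \<partial>\<mu>)"
    using int int' by simp
  also have "\<dots> \<le> (\<integral>\<theta>. 2 * ((1 - \<theta>) * (\<phi> t \<theta>)\<^sup>2) + (L + \<bar>\<phi>0\<bar>)\<^sup>2 - (\<phi> t \<theta>)\<^sup>2 \<partial>\<mu>)"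
  proof (rule integral_mono)
    fix \<theta> assume \<theta>: "\<theta> \<in> space \<mu>"
    define y where "y = \<bar>\<phi> t \<theta>\<bar>"
    have y2: "(\<phi> t \<theta>)\<^sup>2 = y\<^sup>2"
      by (simp add: y_def)
    have "\<theta> * (\<phi>0 * \<phi> t \<theta>) \<le> \<bar>\<theta> * (\<phi>0 * \<phi> t \<theta>)\<bar>"
      by simp
    also have "\<dots> \<le> \<bar>\<phi>0\<bar> * y"
      using \<theta> by (auto simp: y_def abs_mult mult_left_le_one_le zero_le_mult_iff)
    finally have "\<phi>0 * (\<theta> * \<phi> t \<theta>) \<le> \<bar>\<phi>0\<bar> * y"
      by (simp add: mult.left_commute)
    \<comment> \<open>Completing the square: \<open>2 * (L + \<bar>\<phi>0\<bar>) * y \<le>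
      y\<^sup>2 + (L + \<bar>\<phi>0\<bar>)\<^sup>2\<close>.\<close>
    moreover have "0 \<le> (y - (L + \<bar>\<phi>0\<bar>))\<^sup>2"
      by simp
    ultimately show "2 * L * \<bar>\<phi> t \<theta>\<bar> + (2 * \<phi>0 * (\<theta> * \<phi> t \<theta>) - 2 * (\<theta> * (\<phi> t \<theta>)\<^sup>2))
        \<le> 2 * ((1 - \<theta>) * (\<phi> t \<theta>)\<^sup>2) + (L + \<bar>\<phi>0\<bar>)\<^sup>2 - (\<phi> t \<theta>)\<^sup>2"
      unfolding y2 y_def[symmetric] power2_diff by (simp add: algebra_simps)
  qed (use int int' in auto)
  also have "\<dots> = 2 * energy t + (L + \<bar>\<phi>0\<bar>)\<^sup>2 * measure \<mu> (space \<mu>) - sqnorm t"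
    using int int' by (simp add: energy_def sqnorm_def)
  finally show ?thesis
    by simp
qed

text \<open>The a priori bound. Neither \<open>F\<close> nor \<open>\<phi>\<close> nor the bound
  \<open>M\<close> enters it, which later allows \<epsilon> to be fixed before \<open>F\<close> and
  \<open>\<phi>\<close>.\<close>

definition K :: real
  where "K = exp (2 * T) * ((\<phi>0\<^sup>2 + (L + \<bar>\<phi>0\<bar>)\<^sup>2) * measure \<mu> (space \<mu>))"

lemma energy_initial: "energy 0 \<le> \<phi>0\<^sup>2 * measure \<mu> (space \<mu>)"
proof -
  have "energy 0 \<le> (\<integral>\<theta>. \<phi>0\<^sup>2 \<partial>\<mu>)"
    unfolding energy_def
    by (rule integral_mono)
       (use T in \<open>auto intro!: energy_integrable simp: initial mult_left_le_one_le\<close>)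
  then show ?thesis
    by (simp add: mult.commute)
qed

text \<open>Gronwall's argument with the dissipation integral \<open>P\<close> kept inside the
  decaying quantity \<open>G\<close>, so that a single monotonicity statement controls the energy
  and the time integral of \<open>sqnorm\<close> together.\<close>

lemma energy_estimate:
  assumes t: "t \<in> {0..T}"
  shows "energy t + integral {0..t} sqnorm \<le> K"
proof -
  define A where "A = (L + \<bar>\<phi>0\<bar>)\<^sup>2 * measure \<mu> (space \<mu>)"
  define P where "P s = integral {0..s} sqnorm" for s
  define G where "G s = exp (- 2 * s) * (energy s + A + P s)" for s
  have A: "A \<ge> 0"
    by (simp add: A_def)
  have P_nonneg: "P s \<ge> 0" if "s \<in> {0..T}" for s
    unfolding P_def using that
    by (intro integral_nonneg integrable_continuous_real continuous_on_subset[OF continuous_sqnorm])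
       (auto simp: sqnorm_nonneg)
  have P_der: "(P has_real_derivative sqnorm s) (at s within {0..T})" if "s \<in> {0..T}" for s
    unfolding P_def[abs_def] by (rule integral_has_real_derivative[OF continuous_sqnorm that])
  have "G t \<le> G 0"
  proof (rule DERIV_nonpos_imp_decreasing_open[where f = G])
    fix s assume s: "0 < s" "s < t"
    then have s': "s \<in> {0<..<T}"
      using t by simp
    define E' where "E' = (\<integral>\<theta>. 2 * \<phi> s \<theta> * flux s \<theta> \<partial>\<mu>)"
    have "(P has_real_derivative sqnorm s) (at s)"
      using P_der[of s] s t at_within_Icc_at[of 0 s T] by simp
    then have "(G has_real_derivative exp (- 2 * s) * (E' + sqnorm s - 2 * (energy s + A + P s))) (at s)"
      unfolding G_def E'_def
      by (auto intro!: derivative_eq_intros energy_derivative[OF s'] simp: algebra_simps)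
    \<comment> \<open>By the energy inequality the left-hand side is at most
      \<open>- A - 2 * P s\<close>. Adding the constant \<open>A\<close> inside \<open>G\<close> is
      what absorbs the inhomogeneous term.\<close>
    moreover have "E' + sqnorm s - 2 * (energy s + A + P s) \<le> 0"
      using energy_inequality[OF s'] A P_nonneg[of s] s' unfolding E'_def[symmetric] A_def[symmetric] by auto
    ultimately show "\<exists>y. DERIV G s :> y \<and> y \<le> 0"
      by (meson exp_ge_zero mult_nonneg_nonpos)
  next
    have "continuous_on {0..T} P"
      using P_der by (rule DERIV_continuous_on)
    then have "continuous_on {0..T} G"
      unfolding G_def by (intro continuous_intros continuous_energy)
    then show "continuous_on {0..t} G"
      by (rule continuous_on_subset) (use t in auto)
  qed (use t in auto)
  also have "G 0 = energy 0 + A"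
    by (simp add: G_def P_def)
  also have "\<dots> \<le> (\<phi>0\<^sup>2 + (L + \<bar>\<phi>0\<bar>)\<^sup>2) * measure \<mu> (space \<mu>)"
    using energy_initial by (simp add: A_def distrib_right)
  finally have "exp (2 * t) * G t \<le> exp (2 * t) * ((\<phi>0\<^sup>2 + (L + \<bar>\<phi>0\<bar>)\<^sup>2) * measure \<mu> (space \<mu>))"
    by simp
  also have "\<dots> \<le> K"
    unfolding K_def using t by (intro mult_right_mono) auto
  also have "exp (2 * t) * G t = energy t + A + P t"
    by (simp add: G_def mult.assoc[symmetric] exp_add[symmetric])
  finally show ?thesis
    using A by (simp add: P_def)
qed

lemma K_nonneg: "K \<ge> 0"
  by (simp add: K_def)

lemma energy_le: "t \<in> {0..T} \<Longrightarrow> energy t \<le> K"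
proof -
  assume t: "t \<in> {0..T}"
  then have "integral {0..t} sqnorm \<ge> 0"
    by (intro integral_nonneg integrable_continuous_real continuous_on_subset[OF continuous_sqnorm])
       (auto simp: sqnorm_nonneg)
  then show ?thesis
    using energy_estimate[OF t] by simp
qed

section \<open>Membership in the Bochner spaces\<close>

lemma L2w_norm_weight:
  assumes "v \<in> borel_measurable unit_lebesgue"
  shows "L2w_norm (weight \<alpha>) v = sqrt (\<integral>\<theta>. (v \<theta>)\<^sup>2 \<partial>\<mu>)"
  using assms unfolding L2w_norm_def by (subst integral_weight[OF \<alpha>]) auto

text \<open>The factor \<open>1 - \<theta>\<close> is moved from the weight to the integrand, so
  that both norms are expressed through the same measure.\<close>

lemma L2w_norm_weight0:
  assumes [measurable]: "v \<in> borel_measurable unit_lebesgue"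
  shows "L2w_norm (weight0 \<alpha>) v = sqrt (\<integral>\<theta>. (1 - \<theta>) * (v \<theta>)\<^sup>2 \<partial>\<mu>)"
proof -
  have [measurable]: "(\<lambda>\<theta>. \<theta>) \<in> borel_measurable unit_lebesgue"
    by (rule borel_measurable_unit_lebesgue) simp
  show ?thesis
    unfolding L2w_norm_def weight0_def mult.assoc[symmetric]
    by (subst integral_weight[OF \<alpha>]) (auto simp: mult.commute)
qed

lemma solution_in_L2w:
  assumes t: "t \<in> {0..T}"
  shows "\<phi> t \<in> L2w (weight \<alpha>)" "\<phi> t \<in> L2w (weight0 \<alpha>)"
proof -
  have [measurable]: "(\<lambda>\<theta>. \<theta>) \<in> borel_measurable unit_lebesgue"
    by (rule borel_measurable_unit_lebesgue) simp
  note [measurable] = solution_measurable[OF t]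
  show "\<phi> t \<in> L2w (weight \<alpha>)"
    unfolding L2w_def using solution_sq_integrable[OF t]
    by (auto simp: set_integrable_weight_iff[OF \<alpha>])
  have "set_integrable lebesgue {0<..<1} (\<lambda>\<theta>. ((1 - \<theta>) * (\<phi> t \<theta>)\<^sup>2) * weight \<alpha> \<theta>)"
    using energy_integrable[OF t] by (subst set_integrable_weight_iff[OF \<alpha>]) auto
  then show "\<phi> t \<in> L2w (weight0 \<alpha>)"
    unfolding L2w_def weight0_def by (simp add: mult_ac)
qed

lemma L2w_norm_solution:
  assumes t: "t \<in> {0..T}"
  shows "L2w_norm (weight \<alpha>) (\<phi> t) = sqrt (sqnorm t)" "L2w_norm (weight0 \<alpha>) (\<phi> t) = sqrt (energy t)"
  using solution_measurable[OF t]
  by (simp_all add: L2w_norm_weight L2w_norm_weight0 sqnorm_def energy_def)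

text \<open>For each \<theta>, continuity in time gives pointwise convergence, and
  \<open>(2 * B)\<^sup>2\<close> is an integrable majorant. The second integral lies between 0 and
  the first.\<close>

lemma grid_difference_tendsto:
  assumes t: "t \<in> {0..T}"
  shows "(\<lambda>n. \<integral>\<theta>. (\<phi> (grid n t) \<theta> - \<phi> t \<theta>)\<^sup>2 \<partial>\<mu>) \<longlonglongrightarrow> 0"
    and "(\<lambda>n. \<integral>\<theta>. (1 - \<theta>) * (\<phi> (grid n t) \<theta> - \<phi> t \<theta>)\<^sup>2 \<partial>\<mu>) \<longlonglongrightarrow> 0"
proof -
  note [measurable] = solution_measurable_\<mu>[OF t] solution_measurable_\<mu>[OF grid_mem[OF t]]
  have bound: "(\<phi> (grid n t) \<theta> - \<phi> t \<theta>)\<^sup>2 \<le> (2 * B)\<^sup>2" if "\<theta> \<in> {0<..<1}" for n \<theta>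
  proof -
    have "\<bar>\<phi> (grid n t) \<theta> - \<phi> t \<theta>\<bar> \<le> 2 * B"
      using solution_bound[OF that t] solution_bound[OF that grid_mem[OF t, of n]] by linarith
    from power_mono[OF this, of 2] show ?thesis
      by simp
  qed
  have lim: "(\<lambda>n. (\<phi> (grid n t) \<theta> - \<phi> t \<theta>)\<^sup>2) \<longlonglongrightarrow> 0" if "\<theta> \<in> {0<..<1}" for \<theta>
  proof -
    have "(\<lambda>n. \<phi> (grid n t) \<theta>) \<longlonglongrightarrow> \<phi> t \<theta>"
      by (rule continuous_on_tendsto_compose[OF continuous_in_time[OF that] grid_tendsto])
         (use t grid_mem[OF t] in auto)
    then have "(\<lambda>n. (\<phi> (grid n t) \<theta> - \<phi> t \<theta>)\<^sup>2) \<longlonglongrightarrow> (\<phi> t \<theta> - \<phi> t \<theta>)\<^sup>2"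
      by (intro tendsto_intros)
    then show ?thesis
      by simp
  qed
  have "(\<lambda>n. \<integral>\<theta>. (\<phi> (grid n t) \<theta> - \<phi> t \<theta>)\<^sup>2 \<partial>\<mu>) \<longlonglongrightarrow> (\<integral>\<theta>. 0 \<partial>\<mu>)"
    by (rule integral_dominated_convergence[where w = "\<lambda>_. (2 * B)\<^sup>2"])
       (use bound lim in \<open>auto intro!: AE_I2\<close>)
  then show *: "(\<lambda>n. \<integral>\<theta>. (\<phi> (grid n t) \<theta> - \<phi> t \<theta>)\<^sup>2 \<partial>\<mu>) \<longlonglongrightarrow> 0"
    by simp
  show "(\<lambda>n. \<integral>\<theta>. (1 - \<theta>) * (\<phi> (grid n t) \<theta> - \<phi> t \<theta>)\<^sup>2 \<partial>\<mu>) \<longlonglongrightarrow> 0"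
  proof (rule tendsto_sandwich[OF _ _ tendsto_const *])
    show "\<forall>\<^sub>F n in sequentially. 0 \<le> (\<integral>\<theta>. (1 - \<theta>) * (\<phi> (grid n t) \<theta> - \<phi> t \<theta>)\<^sup>2 \<partial>\<mu>)"
      by (rule always_eventually, rule allI, rule integral_nonneg_AE) (auto intro!: AE_I2)
    show "\<forall>\<^sub>F n in sequentially. (\<integral>\<theta>. (1 - \<theta>) * (\<phi> (grid n t) \<theta> - \<phi> t \<theta>)\<^sup>2 \<partial>\<mu>)
        \<le> (\<integral>\<theta>. (\<phi> (grid n t) \<theta> - \<phi> t \<theta>)\<^sup>2 \<partial>\<mu>)"
      by (intro always_eventually allI integral_mono' bounded_integrable[where K = "(2 * B)\<^sup>2"])
         (use bound in \<open>auto simp: mult_left_le_one_le\<close>)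
  qed
qed

text \<open>The approximating simple functions are \<open>\<phi> (grid n t)\<close>: they take
  finitely many values, each a time slice of the solution, and converge at every \<open>t\<close> in
  the interval. The slice at time 0 may occur as a value and also lies in both spaces.\<close>

lemma strongly_measurable_solution:
  "strongly_measurable_L2w T (weight \<alpha>) \<phi>" "strongly_measurable_L2w T (weight0 \<alpha>) \<phi>"
proof -
  have simple: "simple_function (lebesgue_on {0<..<T}) (\<lambda>t. \<phi> (grid n t))" for n
    by (rule simple_function_compose1[OF simple_function_grid])
  have meas: "(\<lambda>\<theta>. \<phi> (grid n t) \<theta> - \<phi> t \<theta>) \<in> borel_measurable unit_lebesgue" if "t \<in> {0..T}" for n t
    using solution_measurable[OF that] solution_measurable[OF grid_mem[OF that]]
    by (rule borel_measurable_diff[rotated])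
  have mem: "t \<in> {0..T}" "grid n t \<in> {0..T}" if "t \<in> {0<..<T}" for n t
    using that grid_mem[of t T n] by auto
  have "(\<lambda>n. L2w_norm (weight \<alpha>) (\<lambda>\<theta>. \<phi> (grid n t) \<theta> - \<phi> t \<theta>)) \<longlonglongrightarrow> 0"
    "(\<lambda>n. L2w_norm (weight0 \<alpha>) (\<lambda>\<theta>. \<phi> (grid n t) \<theta> - \<phi> t \<theta>)) \<longlonglongrightarrow> 0"
    if "t \<in> {0<..<T}" for t
    unfolding L2w_norm_weight[OF meas[OF mem(1)[OF that]]] L2w_norm_weight0[OF meas[OF mem(1)[OF that]]]
    using tendsto_real_sqrt[OF grid_difference_tendsto(1)[OF mem(1)[OF that]]]
      tendsto_real_sqrt[OF grid_difference_tendsto(2)[OF mem(1)[OF that]]]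
    by simp_all
  then show "strongly_measurable_L2w T (weight \<alpha>) \<phi>" "strongly_measurable_L2w T (weight0 \<alpha>) \<phi>"
    unfolding strongly_measurable_L2w_def using simple mem
    by (auto intro!: AE_I2 solution_in_L2w exI[of _ "\<lambda>n t. \<phi> (grid n t)"])
qed

text \<open>Together the bounds make the essential supremum a finite nonnegative number. This
  matters because \<open>real_of_ereal\<close> sends infinite values to 0.\<close>

lemma esssup_bounds:
  "0 \<le> esssup (lebesgue_on {0<..<T}) (\<lambda>t. ereal (L2w_norm (weight0 \<alpha>) (\<phi> t)))"
  "esssup (lebesgue_on {0<..<T}) (\<lambda>t. ereal (L2w_norm (weight0 \<alpha>) (\<phi> t))) \<le> ereal (sqrt K)"
proof -
  let ?M = "lebesgue_on {0<..<T}" and ?u = "\<lambda>t. ereal (L2w_norm (weight0 \<alpha>) (\<phi> t))"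
  have eq: "L2w_norm (weight0 \<alpha>) (\<phi> t) = sqrt (energy t)" if "t \<in> space ?M" for t
    using that L2w_norm_solution(2)[of t] by simp
  have "continuous_on {0<..<T} energy"
    by (rule continuous_on_subset[OF continuous_energy]) auto
  then have "energy \<in> borel_measurable ?M"
    by (intro continuous_imp_measurable_on_sets_lebesgue) auto
  then have "(\<lambda>t. ereal (sqrt (energy t))) \<in> borel_measurable ?M"
    by measurable
  then have meas: "?u \<in> borel_measurable ?M"
    by (rule measurable_cong[THEN iffD1, rotated]) (simp add: eq)
  \<comment> \<open>A positive length of the time interval rules out the null measure, for which the
    essential supremum of a constant would be minus infinity.\<close>
  have "emeasure ?M (space ?M) \<noteq> 0"
    using T by (simp add: emeasure_restrict_space)
  then have "0 = esssup ?M (\<lambda>_. 0 :: ereal)"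
    by (simp add: esssup_const)
  also have "\<dots> \<le> esssup ?M ?u"
    by (rule esssup_AE_mono) (auto intro!: AE_I2 simp: eq energy_nonneg)
  finally show "0 \<le> esssup ?M ?u" .
  show "esssup ?M ?u \<le> ereal (sqrt K)"
    by (rule esssup_I[OF meas]) (auto intro!: AE_I2 energy_le simp: eq)
qed

section \<open>Finiteness and size of the two Bochner norms\<close>

lemma solution_in_bochner_Linf: "\<phi> \<in> bochner_Linf T (weight0 \<alpha>)"
  using strongly_measurable_solution esssup_bounds(2)
  by (auto simp: bochner_Linf_def intro: le_less_trans)

lemma bochner_Linf_norm_le: "(bochner_Linf_norm T (weight0 \<alpha>) \<phi>)\<^sup>2 \<le> K"
proof -
  have "0 \<le> bochner_Linf_norm T (weight0 \<alpha>) \<phi>"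
    unfolding bochner_Linf_norm_def using esssup_bounds(1) by (rule real_of_ereal_pos)
  moreover have "bochner_Linf_norm T (weight0 \<alpha>) \<phi> \<le> sqrt K"
    using real_of_ereal_positive_mono[OF esssup_bounds] by (simp add: bochner_Linf_norm_def)
  ultimately have "(bochner_Linf_norm T (weight0 \<alpha>) \<phi>)\<^sup>2 \<le> (sqrt K)\<^sup>2"
    by (intro power_mono)
  then show ?thesis
    using K_nonneg by simp
qed

lemma sqnorm_set_integrable: "set_integrable lebesgue {0<..<T} sqnorm"
  using absolutely_integrable_continuous_real[OF continuous_sqnorm]
  by (simp only: absolutely_integrable_on_Icc_iff_Ioo)

lemma L2w_norm_sq_solution: "t \<in> {0<..<T} \<Longrightarrow> (L2w_norm (weight \<alpha>) (\<phi> t))\<^sup>2 = sqnorm t"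
  using L2w_norm_solution(1)[of t] sqnorm_nonneg by simp

lemma solution_in_bochner_L2: "\<phi> \<in> bochner_L2 T (weight \<alpha>)"
proof -
  have "set_integrable lebesgue {0<..<T} (\<lambda>t. (L2w_norm (weight \<alpha>) (\<phi> t))\<^sup>2)"
    using sqnorm_set_integrable
    by (rule set_integrable_cong[THEN iffD2, rotated -1]) (auto simp: L2w_norm_sq_solution)
  then show ?thesis
    using strongly_measurable_solution by (simp add: bochner_L2_def)
qed

text \<open>The squared norm is the dissipation integral up to time \<open>T\<close>; the energy
  estimate at \<open>T\<close> bounds it once the nonnegative energy is dropped.\<close>

lemma bochner_L2_norm_le: "(bochner_L2_norm T (weight \<alpha>) \<phi>)\<^sup>2 \<le> K"
proof -
  have "(LINT t:{0<..<T}|lebesgue. (L2w_norm (weight \<alpha>) (\<phi> t))\<^sup>2) = (LINT t:{0<..<T}|lebesgue. sqnorm t)"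
    by (intro set_lebesgue_integral_cong) (auto simp: L2w_norm_sq_solution)
  also have "\<dots> = integral {0..T} sqnorm"
    by (simp only: set_lebesgue_integral_eq_integral(2)[OF sqnorm_set_integrable]
        integral_open_interval_real)
  finally have eq: "(LINT t:{0<..<T}|lebesgue. (L2w_norm (weight \<alpha>) (\<phi> t))\<^sup>2) = integral {0..T} sqnorm" .
  have "integral {0..T} sqnorm \<ge> 0"
    by (intro integral_nonneg integrable_continuous_real continuous_sqnorm) (simp add: sqnorm_nonneg)
  moreover have "integral {0..T} sqnorm \<le> K"
    using energy_estimate[of T] energy_nonneg[of T] T by simp
  ultimately show ?thesis
    unfolding bochner_L2_norm_def eq by simp
qed

end

section \<open>Choice of \<epsilon> and conclusion\<close>

theorem theorem1:
  fixes \<alpha> T \<phi>0 L :: real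
  assumes "0 < \<alpha>" and "\<alpha> < 1" and "T > 0" and "L > 0"
  shows "\<exists>\<epsilon>>0. \<forall>F \<phi> :: real \<Rightarrow> real \<Rightarrow> real.
    admissible_rhs T F \<longrightarrow>
    (\<forall>t\<in>{0<..T}. \<forall>x. F t x * x \<le> L * \<bar>x\<bar>) \<longrightarrow>
    extended_solution \<alpha> T \<phi>0 F \<phi> \<longrightarrow>
      \<phi> \<in> bochner_Linf T (weight0 \<alpha>) \<and>
      \<phi> \<in> bochner_L2 T (weight \<alpha>) \<and>
      (bochner_Linf_norm T (weight0 \<alpha>) \<phi>)\<^sup>2 + (bochner_L2_norm T (weight \<alpha>) \<phi>)\<^sup>2
        \<le> energy_const \<epsilon> L \<alpha> \<phi>0 T"
proof -
  \<comment> \<open>This is the value of \<open>K\<close>, written out because \<epsilon> must be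
    chosen before any \<open>F\<close> and \<open>\<phi>\<close> are given.\<close>
  define C where "C = exp (2 * T) * ((\<phi>0\<^sup>2 + (L + \<bar>\<phi>0\<bar>)\<^sup>2) *
    measure (weight_measure \<alpha>) (space (weight_measure \<alpha>)))"
  have C: "C \<ge> 0"
    by (simp add: C_def)
  \<comment> \<open>Solves \<open>L\<^sup>2 * \<alpha> * T / (4 * \<epsilon>) = C + 1\<close>. The
    summand 1 keeps the denominator positive when only \<open>C \<ge> 0\<close> is known.\<close>
  define \<epsilon> where "\<epsilon> = L\<^sup>2 * \<alpha> * T / (4 * (C + 1))"
  have \<epsilon>: "\<epsilon> > 0"
    using assms C by (simp add: \<epsilon>_def)
  have "2 * C \<le> energy_const \<epsilon> L \<alpha> \<phi>0 T"
  proof -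
    have "L\<^sup>2 / (4 * \<epsilon>) * \<alpha> * T = C + 1"
      using assms C by (simp add: \<epsilon>_def)
    then have "C \<le> L\<^sup>2 / (4 * \<epsilon>) * \<alpha> * T * 1"
      by simp
    also have "\<dots> \<le> L\<^sup>2 / (4 * \<epsilon>) * \<alpha> * T * exp (2 * \<epsilon> * T)"
      using assms \<epsilon> by (intro mult_left_mono) auto
    \<comment> \<open>The remaining terms of \<open>energy_const\<close> are nonnegative, so the
      singular term alone dominates \<open>C\<close>; the overall factor 2 accounts for the two
      norms, each with square at most \<open>C\<close>.\<close>
    also have "\<dots> \<le> L\<^sup>2 / (4 * \<epsilon>) * \<alpha> * T * exp (2 * \<epsilon> * T) + (\<phi>0\<^sup>2 * \<alpha> * exp (2 * \<epsilon> * T) +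
        (L\<^sup>2 + \<phi>0\<^sup>2) * (1 - \<alpha>) * exp (2 * \<epsilon> * T) * T)"
      using assms by simp
    finally show ?thesis
      by (simp add: energy_const_def algebra_simps)
  qed
  moreover have "\<phi> \<in> bochner_Linf T (weight0 \<alpha>) \<and> \<phi> \<in> bochner_L2 T (weight \<alpha>) \<and>
      (bochner_Linf_norm T (weight0 \<alpha>) \<phi>)\<^sup>2 + (bochner_L2_norm T (weight \<alpha>) \<phi>)\<^sup>2 \<le> 2 * C"
    if "admissible_rhs T F" "\<forall>t\<in>{0<..T}. \<forall>x. F t x * x \<le> L * \<bar>x\<bar>"
      "extended_solution \<alpha> T \<phi>0 F \<phi>" for F \<phi> :: "real \<Rightarrow> real \<Rightarrow> real"
  proof -
    interpret extended_problem \<alpha> T \<phi>0 L F \<phi>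
      using assms that by unfold_locales auto
    have "K = C"
      by (simp only: K_def C_def)
    then show ?thesis
      using solution_in_bochner_Linf solution_in_bochner_L2 bochner_Linf_norm_le bochner_L2_norm_le
      by simp
  qed
  ultimately show ?thesis
    using \<epsilon> order.trans by (intro exI[of _ \<epsilon>]) blast
qed

end
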